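(* Let $\gamma>0$ and let $F$ be a distribution function on $\mathbb{R}$ with $F\in\mathcal{L}_\gamma$ and $\hat\varphi_F<1$. Let $\{\xi_n\}_{n\ge1}$ be i.i.d. random variables with distribution function $F$, let $S_0=0$, $S_n=\sum_{i=1}^n\xi_i$ for $n\ge1$, and let $M=\sup_{n\ge0}S_n$. Then $$1\le\mathbf{E} e^{\gamma M}\le\frac{1}{1-\hat\varphi_F},$$ and therefore $$\mathbf{P}(M>x)=o(e^{-\gamma x}),\qquad\text{as }x\to\infty.$$
   Context: For a distribution function $F$ on $\mathbb{R}$, let $\overline{F}(x)=1-F(x)$ and $\varphi_F(\alpha)=\int_{-\infty}^\infty e^{\alpha x}\,dF(x)\in[0,\infty]$ for $\alpha\ge0$. For $\gamma\ge0$, $F\in\mathcal{L}_\gamma$ if and only if $\overline{F}(x)>0$ for all $x$ and $\lim_{x\to\infty}\overline{F}(x-k)/\overline{F}(x)=e^{\gamma k}$ for every fixed $k\in\mathbb{R}$. For $F\in\mathcal{L}_\gamma$ write $\hat\varphi_F=\varphi_F(\gamma)$ (possibly infinite). *)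

theory Defs
  imports "HOL-Probability.Probability" "HOL-Library.Landau_Symbols"
begin

text \<open>
  The convention is \<open>F x = P (\<xi> \<le> x)\<close>, so distribution functions are right-continuous.
\<close>

definition distribution_function :: "(real \<Rightarrow> real) \<Rightarrow> bool" where
  "distribution_function F \<longleftrightarrow>
     mono F \<and> (\<forall>x. continuous (at_right x) F) \<and>
     (F \<longlongrightarrow> 0) at_bot \<and> (F \<longlongrightarrow> 1) at_top"

definition tail :: "(real \<Rightarrow> real) \<Rightarrow> real \<Rightarrow> real" where
  "tail F x = 1 - F x"

text \<open>
  \<open>dF\<close> is the Lebesgue--Stieltjes measure of \<open>F\<close>; the integral lives in \<open>ennreal\<close> since it
  may be infinite.
\<close>

definition phi :: "(real \<Rightarrow> real) \<Rightarrow> real \<Rightarrow> ennreal" where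
  "phi F \<alpha> = (\<integral>\<^sup>+ x. ennreal (exp (\<alpha> * x)) \<partial>interval_measure F)"

definition class_L :: "real \<Rightarrow> (real \<Rightarrow> real) set" where
  "class_L \<gamma> = {F. distribution_function F \<and> (\<forall>x. 0 < tail F x) \<and>
     (\<forall>k. ((\<lambda>x. tail F (x - k) / tail F x) \<longlongrightarrow> exp (\<gamma> * k)) at_top)}"

definition partial_sum :: "(nat \<Rightarrow> 'a \<Rightarrow> real) \<Rightarrow> nat \<Rightarrow> 'a \<Rightarrow> real" where
  "partial_sum \<xi> n \<omega> = (\<Sum>i=1..n. \<xi> i \<omega>)"

text \<open>
  The supremum is taken in \<open>ereal\<close>, because on \<open>real\<close> the value of \<open>SUP\<close> over an unbounded set
  is unspecified.
\<close>

definition sup_walk :: "(nat \<Rightarrow> 'a \<Rightarrow> real) \<Rightarrow> 'a \<Rightarrow> ereal" where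
  "sup_walk \<xi> \<omega> = (SUP n. ereal (partial_sum \<xi> n \<omega>))"

text \<open>The exponential, extended by \<open>exp \<infinity> = \<infinity>\<close> and \<open>exp (- \<infinity>) = 0\<close>.\<close>

definition exp_ereal :: "ereal \<Rightarrow> ennreal" where
  "exp_ereal x = (case x of ereal r \<Rightarrow> ennreal (exp r) | PInfty \<Rightarrow> \<infinity> | MInfty \<Rightarrow> 0)"

end

theory Submission
  imports Defs
begin

text \<open>
  Since \<open>exp (\<gamma> M)\<close> is the supremum of the \<open>exp (\<gamma> S\<^sub>n)\<close>, it is bounded by their sum, and by
  independence the expectations of the summands form the geometric series with ratio \<open>phi F \<gamma> < 1\<close>;
  the summand \<open>n = 0\<close> gives the lower bound. As \<open>exp (\<gamma> M)\<close> is integrable, dominated convergence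
  turns Markov's inequality \<open>exp (\<gamma> x) P (M > x) \<le> E (exp (\<gamma> M); M > x)\<close> into the decay rate.
\<close>

lemma measurable_exp_ereal [measurable]: "exp_ereal \<in> borel_measurable borel"
proof -
  have "exp_ereal = (\<lambda>x. if x = \<infinity> then \<infinity> else if x = -\<infinity> then 0 else ennreal (exp (real_of_ereal x)))"
    by (auto simp: exp_ereal_def fun_eq_iff split: ereal.splits)
  also have "\<dots> \<in> borel_measurable borel"
    by measurable
  finally show ?thesis .
qed

lemma exp_ereal_ereal [simp]: "exp_ereal (ereal r) = ennreal (exp r)"
  by (simp add: exp_ereal_def)

lemma mono_exp_ereal: "mono exp_ereal"
  by (rule monoI) (auto simp: exp_ereal_def split: ereal.splits)

text \<open>An increasing bijection commutes with suprema: a finite bound on all the exponentials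
  turns, through \<open>ln\<close>, into a bound on the exponents. An unbounded sequence is covered
  too, with both sides infinite.\<close>

lemma exp_ereal_SUP:
  fixes s :: "nat \<Rightarrow> real"
  assumes "c > 0"
  shows "exp_ereal (ereal c * (SUP n. ereal (s n))) = (SUP n. ennreal (exp (c * s n)))"
proof (rule antisym)
  let ?M = "SUP n. ereal (s n)"
  let ?G = "SUP n. ennreal (exp (c * s n))"
  show "exp_ereal (ereal c * ?M) \<le> ?G"
  proof (cases "?G")
    case (real r)
    have le: "exp (c * s n) \<le> r" for n
      using real SUP_upper[of n UNIV "\<lambda>n. ennreal (exp (c * s n))"] by simp
    \<comment> \<open>Index 0 serves only as a witness that the family is nonempty. Positivity of
      \<open>r\<close> makes \<open>ln r\<close> meaningful and
      \<open>exp (ln r) = r\<close>.\<close>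
    have "r > 0"
      using le[of 0] exp_gt_zero[of "c * s 0"] by linarith
    have "c * s n \<le> ln r" for n
      using le[of n] \<open>r > 0\<close> by (simp add: ln_ge_iff)
    then have "?M \<le> ereal (ln r / c)"
      using assms by (intro SUP_least) (simp add: field_simps)
    then have "ereal c * ?M \<le> ereal c * ereal (ln r / c)"
      using assms by (intro ereal_mult_left_mono) auto
    also have "\<dots> = ereal (ln r)"
      using assms by simp
    finally have "exp_ereal (ereal c * ?M) \<le> exp_ereal (ereal (ln r))"
      by (rule monoD[OF mono_exp_ereal])
    then show ?thesis
      using \<open>r > 0\<close> real by simp
  next
    case top
    then show ?thesis
      by (simp only: top_greatest)
  qed
  show "?G \<le> exp_ereal (ereal c * ?M)"
  proof (rule SUP_least)
    fix n
    have "ereal c * ereal (s n) \<le> ereal c * ?M"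
      using assms by (intro ereal_mult_left_mono SUP_upper) auto
    from monoD[OF mono_exp_ereal this] show "ennreal (exp (c * s n)) \<le> exp_ereal (ereal c * ?M)"
      by simp
  qed
qed

text \<open>As \<open>a < 1\<close> excludes infinity, this is the real geometric series transported
  to \<open>ennreal\<close>.\<close>

lemma suminf_ennreal_geometric:
  fixes a :: ennreal
  assumes "a < 1"
  shows "(\<Sum>n. a ^ n) = 1 / (1 - a)"
proof (cases a)
  case (real p)
  with assms have "p < 1"
    by (simp add: ennreal_less_one_iff)
  with real have "(\<Sum>n. a ^ n) = ennreal (1 / (1 - p))"
    by (simp add: ennreal_power suminf_ennreal2 suminf_geometric)
  also have "\<dots> = 1 / (1 - a)"
    using real \<open>p < 1\<close> by (simp add: ennreal_minus divide_ennreal flip: ennreal_1)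
  finally show ?thesis .
qed (use assms in simp)

lemma (in finite_measure) smallo_tail_of_exp_moment:
  fixes Y :: "'a \<Rightarrow> ereal"
  assumes Y [measurable]: "Y \<in> borel_measurable M"
    and c: "c > 0"
    and fin: "(\<integral>\<^sup>+ \<omega>. exp_ereal (ereal c * Y \<omega>) \<partial>M) < \<infinity>"
  shows "(\<lambda>x. measure M {\<omega> \<in> space M. ereal x < Y \<omega>}) \<in> o[at_top](\<lambda>x. exp (- c * x))"
proof -
  \<comment> \<open>A real-valued integrand makes dominated convergence for Bochner integrals
    applicable. Since \<open>enn2real\<close> sends infinity to 0, \<open>g\<close> is wrong where
    \<open>Y\<close> is infinite, which turns out to be a null set.\<close>
  define g where "g \<omega> = enn2real (exp_ereal (ereal c * Y \<omega>))" for \<omega>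
  \<comment> \<open>The integrand of the truncated moment E(exp(cY); Y > x), dominated by
    \<open>g\<close> uniformly in \<open>x\<close>.\<close>
  define s where "s x \<omega> = indicat_real {\<omega> \<in> space M. ereal x < Y \<omega>} \<omega> * g \<omega>" for x \<omega>
  have [measurable]: "g \<in> borel_measurable M"
    unfolding g_def by measurable
  have [measurable]: "s x \<in> borel_measurable M" for x
    unfolding s_def by measurable
  have g_nonneg: "g \<omega> \<ge> 0" for \<omega>
    by (simp add: g_def)
  have "AE \<omega> in M. exp_ereal (ereal c * Y \<omega>) \<noteq> \<infinity>"
    using fin by (intro nn_integral_PInf_AE) auto
  then have Yfin: "AE \<omega> in M. Y \<omega> \<noteq> \<infinity>"
    by eventually_elim (use c in \<open>auto simp: exp_ereal_def\<close>)
  have "(\<integral>\<^sup>+ \<omega>. ennreal (g \<omega>) \<partial>M) \<le> (\<integral>\<^sup>+ \<omega>. exp_ereal (ereal c * Y \<omega>) \<partial>M)"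
    by (intro nn_integral_mono) (simp add: g_def ennreal_enn2real_if)
  with fin have int_g: "integrable M g"
    by (intro integrableI_nonneg) (auto simp: g_nonneg)
  have bound: "norm (s x \<omega>) \<le> g \<omega>" for x \<omega>
    by (simp add: s_def g_nonneg indicator_def)
  have int_s: "integrable M (s x)" for x
    by (rule Bochner_Integration.integrable_bound[OF int_g])
       (use bound g_nonneg in \<open>auto intro: order_trans\<close>)
  have "((\<lambda>x. integral\<^sup>L M (s x)) \<longlongrightarrow> integral\<^sup>L M (\<lambda>_. 0)) at_top"
  proof (rule integral_dominated_convergence_at_top[OF _ _ int_g])
    show "AE \<omega> in M. ((\<lambda>x. s x \<omega>) \<longlongrightarrow> 0) at_top"
      using Yfin
    proof eventually_elim
      case (elim \<omega>)
      then obtain b where b: "Y \<omega> \<le> ereal b"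
        by (cases "Y \<omega>") auto
      \<comment> \<open>For a fixed outcome with \<open>Y\<close> bounded by \<open>b\<close>, the
        truncation removes everything once \<open>x\<close> passes \<open>b\<close>, so the
        pointwise limit is trivial.\<close>
      have "s x \<omega> = 0" if "x \<ge> b" for x
        using b that by (auto simp: s_def indicator_def not_less intro: order_trans)
      then have "\<forall>\<^sub>F x in at_top. s x \<omega> = 0"
        by (rule eventually_at_top_linorderI)
      then show ?case
        by (rule tendsto_eventually)
    qed
  qed (use bound in auto)
  then have lim: "((\<lambda>x. integral\<^sup>L M (s x)) \<longlongrightarrow> 0) at_top"
    by simp
  \<comment> \<open>On the event Y > x the weight exp(cx) is at most exp(cY). Keeping the indicator
    on the right, rather than the full moment, is what improves O to o.\<close>
  have markov: "measure M {\<omega> \<in> space M. ereal x < Y \<omega>} / exp (- c * x) \<le> integral\<^sup>L M (s x)" for x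
  proof -
    let ?A = "{\<omega> \<in> space M. ereal x < Y \<omega>}"
    have "measure M ?A / exp (- c * x) = (\<integral>\<omega>. indicat_real ?A \<omega> * exp (c * x) \<partial>M)"
      by (simp add: exp_minus field_simps)
    also have "\<dots> \<le> integral\<^sup>L M (s x)"
    proof (rule integral_mono_AE)
      \<comment> \<open>Only almost everywhere: where \<open>Y\<close> is infinite, \<open>g\<close>
        is 0 and the inequality fails.\<close>
      show "AE \<omega> in M. indicat_real ?A \<omega> * exp (c * x) \<le> s x \<omega>"
        using Yfin
      proof eventually_elim
        case (elim \<omega>)
        then show ?case
          using c by (cases "Y \<omega>") (auto simp: s_def g_def indicator_def)
      qed
    qed (auto intro: int_s simp: less_top[symmetric])
    finally show ?thesis .
  qed
  show ?thesis
  proof (rule smalloI_tendsto)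
    show "((\<lambda>x. measure M {\<omega> \<in> space M. ereal x < Y \<omega>} / exp (- c * x)) \<longlongrightarrow> 0) at_top"
      by (rule tendsto_sandwich[OF _ _ tendsto_const lim]) (use markov in auto)
  qed simp
qed

text \<open>A probability law on the line is determined by its distribution function. This lets
  \<open>phi F \<gamma>\<close> be read as the exponential moment of one step of the walk.\<close>

lemma interval_measure_eq_distr:
  assumes "distribution_function F" "prob_space P" "X \<in> borel_measurable P"
    and "cdf (distr P borel X) = F"
  shows "interval_measure F = distr P borel X"
proof (rule cdf_unique)
  have F: "\<And>x y. x \<le> y \<Longrightarrow> F x \<le> F y" "\<And>a. continuous (at_right a) F"
    "(F \<longlongrightarrow> 0) at_bot" "(F \<longlongrightarrow> 1) at_top"
    using assms(1) by (auto simp: distribution_function_def mono_def)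
  show "real_distribution (interval_measure F)"
    by (rule real_distribution_interval_measure[OF F])
  show "real_distribution (distr P borel X)"
    using assms by (simp add: prob_space.real_distribution_distr)
  show "cdf (interval_measure F) = cdf (distr P borel X)"
    using cdf_interval_measure[OF F(1-3)] assms(4) by simp
qed

theorem lemma1:
  fixes P :: "'a measure"
    and \<xi> :: "nat \<Rightarrow> 'a \<Rightarrow> real"
    and F :: "real \<Rightarrow> real"
    and \<gamma> :: real
  assumes "prob_space P"
    and "\<gamma> > 0"
    and "distribution_function F"
    and "F \<in> class_L \<gamma>"
    and "phi F \<gamma> < 1"
    and "prob_space.indep_vars P (\<lambda>_. borel) \<xi> {1..}"
    and "\<And>n. n \<ge> 1 \<Longrightarrow> cdf (distr P borel (\<xi> n)) = F"
  shows "1 \<le> (\<integral>\<^sup>+ \<omega>. exp_ereal (ereal \<gamma> * sup_walk \<xi> \<omega>) \<partial>P) \<and>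
         (\<integral>\<^sup>+ \<omega>. exp_ereal (ereal \<gamma> * sup_walk \<xi> \<omega>) \<partial>P) \<le> 1 / (1 - phi F \<gamma>) \<and>
         (\<lambda>x. measure P {\<omega> \<in> space P. ereal x < sup_walk \<xi> \<omega>})
           \<in> o[at_top](\<lambda>x. exp (- \<gamma> * x))"
proof -
  interpret prob_space P by fact
  have rv [measurable]: "\<xi> i \<in> borel_measurable P" if "i \<ge> 1" for i
    using assms(6) that by (auto simp: indep_vars_def)
  have S_meas [measurable]: "partial_sum \<xi> n \<in> borel_measurable P" for n
    unfolding partial_sum_def by (intro borel_measurable_sum rv) auto
  have M_meas [measurable]: "sup_walk \<xi> \<in> borel_measurable P"
    unfolding sup_walk_def by measurable
  have step: "(\<integral>\<^sup>+ \<omega>. ennreal (exp (\<gamma> * \<xi> i \<omega>)) \<partial>P) = phi F \<gamma>" if "i \<ge> 1" for i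
    using interval_measure_eq_distr[OF assms(3,1) rv[OF that] assms(7)[OF that]] rv[OF that]
    by (simp add: phi_def nn_integral_distr)
  \<comment> \<open>The exponential of a sum is a product of independent factors. Working in
    \<open>ennreal\<close> avoids integrability side conditions, and \<open>n = 0\<close> gives the
    empty product 1.\<close>
  have moment: "(\<integral>\<^sup>+ \<omega>. ennreal (exp (\<gamma> * partial_sum \<xi> n \<omega>)) \<partial>P) = phi F \<gamma> ^ n" for n
  proof -
    have "indep_vars (\<lambda>_. borel) \<xi> {1..n}"
      by (rule indep_vars_subset[OF assms(6)]) auto
    then have indep: "indep_vars (\<lambda>_. borel) (\<lambda>i \<omega>. ennreal (exp (\<gamma> * \<xi> i \<omega>))) {1..n}"
      by (rule indep_vars_compose2) measurable
    have "(\<integral>\<^sup>+ \<omega>. ennreal (exp (\<gamma> * partial_sum \<xi> n \<omega>)) \<partial>P)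
        = (\<integral>\<^sup>+ \<omega>. (\<Prod>i=1..n. ennreal (exp (\<gamma> * \<xi> i \<omega>))) \<partial>P)"
      by (simp add: partial_sum_def sum_distrib_left exp_sum prod_ennreal)
    also have "\<dots> = (\<Prod>i=1..n. \<integral>\<^sup>+ \<omega>. ennreal (exp (\<gamma> * \<xi> i \<omega>)) \<partial>P)"
      by (rule indep_vars_nn_integral[OF _ indep]) auto
    also have "\<dots> = (\<Prod>i=1..n. phi F \<gamma>)"
      by (intro prod.cong) (auto simp: step)
    finally show ?thesis by simp
  qed
  let ?E = "\<integral>\<^sup>+ \<omega>. exp_ereal (ereal \<gamma> * sup_walk \<xi> \<omega>) \<partial>P"
  have exp_M: "exp_ereal (ereal \<gamma> * sup_walk \<xi> \<omega>)
      = (SUP n. ennreal (exp (\<gamma> * partial_sum \<xi> n \<omega>)))" for \<omega>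
    unfolding sup_walk_def by (rule exp_ereal_SUP) fact
  have "1 \<le> exp_ereal (ereal \<gamma> * sup_walk \<xi> \<omega>)" for \<omega>
    unfolding exp_M by (rule SUP_upper2[of 0]) (auto simp: partial_sum_def)
  then have "(\<integral>\<^sup>+ \<omega>. 1 \<partial>P) \<le> ?E"
    by (intro nn_integral_mono)
  then have lower: "1 \<le> ?E"
    by (simp add: emeasure_space_1)
  have "exp_ereal (ereal \<gamma> * sup_walk \<xi> \<omega>)
      \<le> (\<Sum>n. ennreal (exp (\<gamma> * partial_sum \<xi> n \<omega>)))" for \<omega>
    unfolding exp_M
  proof (rule SUP_least)
    fix n
    \<comment> \<open>The single term is written as a finite partial sum over a singleton, to be
      compared with the whole series.\<close>
    have "(\<Sum>k\<in>{n}. ennreal (exp (\<gamma> * partial_sum \<xi> k \<omega>)))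
        \<le> (\<Sum>k. ennreal (exp (\<gamma> * partial_sum \<xi> k \<omega>)))"
      by (rule sum_le_suminf) (simp_all only: summableI finite.intros zero_le)
    then show "ennreal (exp (\<gamma> * partial_sum \<xi> n \<omega>)) \<le> (\<Sum>k. ennreal (exp (\<gamma> * partial_sum \<xi> k \<omega>)))"
      by (simp only: sum.insert sum.empty finite.intros empty_iff not_False_eq_True add_0_right)
  qed
  then have "?E \<le> (\<integral>\<^sup>+ \<omega>. (\<Sum>n. ennreal (exp (\<gamma> * partial_sum \<xi> n \<omega>))) \<partial>P)"
    by (intro nn_integral_mono)
  also have "\<dots> = (\<Sum>n. phi F \<gamma> ^ n)"
    by (subst nn_integral_suminf) (simp_all add: moment)
  also have "\<dots> = 1 / (1 - phi F \<gamma>)"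
    by (rule suminf_ennreal_geometric) fact
  finally have upper: "?E \<le> 1 / (1 - phi F \<gamma>)" .
  \<comment> \<open>Continues from \<open>upper\<close>: \<open>phi F \<gamma> < 1\<close> keeps the
    denominator away from 0, where the \<open>ennreal\<close> quotient would be infinite. This
    yields the finite moment required for the tail estimate.\<close>
  also have "\<dots> < \<infinity>"
    using assms(5) by (simp add: ennreal_divide_eq_top_iff less_top[symmetric] diff_eq_0_iff_ennreal not_le)
  finally show ?thesis
    using lower upper smallo_tail_of_exp_moment[OF M_meas assms(2)] by blast
qed

end
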